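(* For $z_E,z_I\in\mathbb{C}$ put $s=z_E+z_I$, $$Q(z_E,z_I)=\frac{1+\frac12z_E+\frac18z_Es}{1-\frac12z_I+\frac18z_Is},\qquad R(z_E,z_I)=\frac{1+z_E+\frac16z_Es+\frac13(z_E-z_I)\,s\,Q(z_E,z_I)}{1-z_I+\frac16z_Is}.$$ For any fixed $z_E\in\mathbb{C}$, as $|z_I|\to\infty$ with $\operatorname{Re}(z_I)\le0$, $$Q(z_E,z_I)\sim\frac{z_E}{z_I},\qquad R(z_E,z_I)\sim-\frac{z_E}{z_I}\to0,$$ in the sense that $z_I\,Q(z_E,z_I)\to z_E$ and $z_I\,R(z_E,z_I)\to-z_E$; in particular $R(z_E,z_I)\to0$.
   Context: $R(z_E,z_I)$ is the one-step stability function and $Q(z_E,z_I)$ the stage amplification factor ($u^*=Q u^n$, $u^{n+1}=Ru^n$) obtained by applying the following two-stage method, with $\mathcal{F}(u)=\lambda_Eu$, $\mathcal{G}(u)=\lambda_Iu$, $z_E=\lambda_E\Delta t$, $z_I=\lambda_I\Delta t$, to the scalar test equation $u_t=\lambda_Eu+\lambda_Iu$, $\lambda_E,\lambda_I\in\mathbb{C}$: $$u^*=u^n+\frac{\Delta t}{2}\mathcal{F}(u^n)+\frac{\Delta t^2}{8}\dot{\mathcal{F}}(u^n)+\frac{\Delta t}{2}\mathcal{G}(u^* )-\frac{\Delta t^2}{8}\dot{\mathcal{G}}(u^* ),$$ $$u^{n+1}=u^n+\Delta t\,\mathcal{F}(u^n)+\frac{\Delta t^2}{6}\left[\dot{\mathcal{F}}(u^n)+2\dot{\mathcal{F}}(u^*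 )\right]+\Delta t\,\mathcal{G}(u^{n+1})-\frac{\Delta t^2}{6}\left[\dot{\mathcal{G}}(u^{n+1})+2\dot{\mathcal{G}}(u^* )\right],$$ where $\dot{\mathcal{F}}=\mathcal{F}_u(\mathcal{F}+\mathcal{G})$ and $\dot{\mathcal{G}}=\mathcal{G}_u(\mathcal{F}+\mathcal{G})$. For fixed $z_E$ the denominators are nonzero once $|z_I|$ is large enough. *)

theory Defs
  imports "HOL-Analysis.Analysis"
begin

text \<open>The time derivative of \<open>H (u t)\<close> along solutions of \<open>u' = F u + G u\<close>, by the chain rule.\<close>

definition total_deriv ::
    "(complex \<Rightarrow> complex) \<Rightarrow> (complex \<Rightarrow> complex) \<Rightarrow> (complex \<Rightarrow> complex) \<Rightarrow> complex \<Rightarrow> complex" where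
  "total_deriv F G H u = deriv H u * (F u + G u)"

definition imex_step ::
    "(complex \<Rightarrow> complex) \<Rightarrow> (complex \<Rightarrow> complex) \<Rightarrow> real \<Rightarrow> complex \<Rightarrow> complex \<Rightarrow> complex \<Rightarrow> bool" where
  "imex_step F G dt u us u1 \<longleftrightarrow>
     us = u + of_real dt / 2 * F u + (of_real dt)\<^sup>2 / 8 * total_deriv F G F u
            + of_real dt / 2 * G us - (of_real dt)\<^sup>2 / 8 * total_deriv F G G us \<and>
     u1 = u + of_real dt * F u
            + (of_real dt)\<^sup>2 / 6 * (total_deriv F G F u + 2 * total_deriv F G F us)
            + of_real dt * G u1
            - (of_real dt)\<^sup>2 / 6 * (total_deriv F G G u1 + 2 * total_deriv F G G us)"

definition stage_den :: "complex \<Rightarrow> complex \<Rightarrow> complex" where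
  "stage_den zE zI = 1 - zI / 2 + zI * (zE + zI) / 8"

definition step_den :: "complex \<Rightarrow> complex \<Rightarrow> complex" where
  "step_den zE zI = 1 - zI + zI * (zE + zI) / 6"

definition stage_factor :: "complex \<Rightarrow> complex \<Rightarrow> complex" where
  "stage_factor zE zI = (1 + zE / 2 + zE * (zE + zI) / 8) / stage_den zE zI"

definition stability_fun :: "complex \<Rightarrow> complex \<Rightarrow> complex" where
  "stability_fun zE zI = (1 + zE + zE * (zE + zI) / 6 + (zE - zI) * (zE + zI) * stage_factor zE zI / 3) / step_den zE zI"

definition left_half_plane_at_infinity :: "complex filter" where
  "left_half_plane_at_infinity = inf at_infinity (principal {z. Re z \<le> 0})"

text \<open>On the scalar test equation the method is solvable exactly by the amplification factors
  \<open>stage_factor\<close> and \<open>stability_fun\<close>, as long as their denominators do not vanish.\<close>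

lemma imex_step_test_equation:
  fixes lE lI u us u1 :: complex and dt :: real
  defines "zE \<equiv> lE * of_real dt" and "zI \<equiv> lI * of_real dt"
  assumes nz: "stage_den zE zI \<noteq> 0" "step_den zE zI \<noteq> 0"
  shows "imex_step (\<lambda>v. lE * v) (\<lambda>v. lI * v) dt u us u1 \<longleftrightarrow>
           us = stage_factor zE zI * u \<and> u1 = stability_fun zE zI * u"
proof -
  have d: "deriv (\<lambda>v. c * v) w = c" for c w :: complex
    by (rule DERIV_imp_deriv) (auto intro!: derivative_eq_intros)
  have us: "us = u + of_real dt / 2 * (lE * u) + (of_real dt)\<^sup>2 / 8 * (lE * (lE * u + lI * u))
            + of_real dt / 2 * (lI * us) - (of_real dt)\<^sup>2 / 8 * (lI * (lE * us + lI * us))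
     \<longleftrightarrow> us = stage_factor zE zI * u" (is "?L \<longleftrightarrow> _")
  proof -
    have "?L \<longleftrightarrow> stage_den zE zI * us = (1 + zE / 2 + zE * (zE + zI) / 8) * u"
      unfolding stage_den_def zE_def zI_def by (auto simp: algebra_simps power2_eq_square; algebra)
    also have "\<dots> \<longleftrightarrow> us = stage_factor zE zI * u"
      using nz by (auto simp: stage_factor_def field_simps)
    finally show ?thesis .
  qed
  have u1: "u1 = u + of_real dt * (lE * u)
            + (of_real dt)\<^sup>2 / 6 * (lE * (lE * u + lI * u) + 2 * (lE * (lE * us + lI * us)))
            + of_real dt * (lI * u1)
            - (of_real dt)\<^sup>2 / 6 * (lI * (lE * u1 + lI * u1) + 2 * (lI * (lE * us + lI * us)))
     \<longleftrightarrow> u1 = stability_fun zE zI * u" (is "?L \<longleftrightarrow> _") if "us = stage_factor zE zI * u"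
  proof -
    have "u1 - (u + of_real dt * (lE * u)
            + (of_real dt)\<^sup>2 / 6 * (lE * (lE * u + lI * u) + 2 * (lE * (lE * us + lI * us)))
            + of_real dt * (lI * u1)
            - (of_real dt)\<^sup>2 / 6 * (lI * (lE * u1 + lI * u1) + 2 * (lI * (lE * us + lI * us))))
        = step_den zE zI * u1
          - ((1 + zE + zE * (zE + zI) / 6) * u + (zE - zI) * (zE + zI) / 3 * us)"
      unfolding step_den_def zE_def zI_def by (simp add: field_simps power2_eq_square)
    then have "?L \<longleftrightarrow> step_den zE zI * u1
        = (1 + zE + zE * (zE + zI) / 6) * u + (zE - zI) * (zE + zI) / 3 * us"
      by (metis (no_types, lifting) eq_iff_diff_eq_0)
    also have "\<dots> \<longleftrightarrow> step_den zE zI * u1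
        = (1 + zE + zE * (zE + zI) / 6 + (zE - zI) * (zE + zI) * stage_factor zE zI / 3) * u"
      unfolding that by (simp add: algebra_simps)
    also have "\<dots> \<longleftrightarrow> u1 = stability_fun zE zI * u"
      using nz(2) by (simp add: stability_fun_def nonzero_eq_divide_eq mult.commute)
    finally show ?thesis .
  qed
  show ?thesis
    unfolding imex_step_def total_deriv_def d using us u1 by blast
qed

end

theory Submission
  imports Defs
begin

text \<open>Dividing numerator and denominator by \<open>zI\<^sup>2\<close> turns both \<open>zI * Q\<close> and \<open>zI * R\<close> into rational
  expressions in \<open>inverse zI\<close> (and, for \<open>R\<close>, in \<open>zI * Q\<close>) that are regular at \<open>inverse zI = 0\<close>; the
  limits then hold along every approach to infinity.\<close>

lemma eventually_nonzero_at_infinity: "eventually (\<lambda>z::'a::real_normed_vector. z \<noteq> 0) at_infinity"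
  by (auto simp: eventually_at_infinity intro!: exI[of _ 1])

text \<open>The factor \<open>z\<close> cancels one power of the \<open>z\<^sup>2\<close> divided
  out, so the numerator of \<open>Q\<close> is divided by \<open>z\<close> only. If
  \<open>stage_den a z\<close> vanishes, both sides are 0 by the convention x / 0 = 0.\<close>

lemma stage_factor_rescaled:
  assumes "z \<noteq> 0"
  shows "z * stage_factor a z =
    (inverse z * (1 + a / 2 + a\<^sup>2 / 8) + a / 8) /
    ((inverse z)\<^sup>2 - inverse z / 2 + (a * inverse z + 1) / 8)"
proof -
  have num: "inverse z * (1 + a / 2 + a\<^sup>2 / 8) + a / 8 = (1 + a / 2 + a * (a + z) / 8) / z"
    using assms by (simp add: field_simps power2_eq_square)
  have den: "(inverse z)\<^sup>2 - inverse z / 2 + (a * inverse z + 1) / 8 = stage_den a z / z\<^sup>2"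
    using assms by (simp add: stage_den_def field_simps power2_eq_square)
  show ?thesis
    unfolding num den stage_factor_def using assms by (simp add: power2_eq_square)
qed

lemma stability_fun_rescaled:
  assumes "z \<noteq> 0"
  shows "z * stability_fun a z =
    (inverse z * (1 + a) + a * (a * inverse z + 1) / 6
       + (a * inverse z - 1) * (a * inverse z + 1) * (z * stage_factor a z) / 3) /
    ((inverse z)\<^sup>2 - inverse z + (a * inverse z + 1) / 6)"
proof -
  \<comment> \<open>The stage factor enters linearly, so it is kept as a free \<open>q\<close>; its
    own limit is inserted later.\<close>
  have num: "inverse z * (1 + a) + a * (a * inverse z + 1) / 6
       + (a * inverse z - 1) * (a * inverse z + 1) * (z * q) / 3
     = (1 + a + a * (a + z) / 6 + (a - z) * (a + z) * q / 3) / z" for q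
    using assms by (simp add: field_simps power2_eq_square)
  have den: "(inverse z)\<^sup>2 - inverse z + (a * inverse z + 1) / 6 = step_den a z / z\<^sup>2"
    using assms by (simp add: step_den_def field_simps power2_eq_square)
  show ?thesis
    unfolding num den stability_fun_def using assms by (simp add: power2_eq_square)
qed

lemma tendsto_stage_factor_at_infinity:
  "((\<lambda>z. z * stage_factor a z) \<longlongrightarrow> a) at_infinity"
proof -
  \<comment> \<open>The limit of the denominator is 1/8, hence nonzero, and the quotient rule
    applies.\<close>
  have "((\<lambda>z. (inverse z * (1 + a / 2 + a\<^sup>2 / 8) + a / 8) /
      ((inverse z)\<^sup>2 - inverse z / 2 + (a * inverse z + 1) / 8)) \<longlongrightarrow>
      (0 * (1 + a / 2 + a\<^sup>2 / 8) + a / 8) / (0\<^sup>2 - 0 / 2 + (a * 0 + 1) / 8)) at_infinity"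
    by (intro tendsto_intros tendsto_inverse_0) auto
  then have "((\<lambda>z. (inverse z * (1 + a / 2 + a\<^sup>2 / 8) + a / 8) /
      ((inverse z)\<^sup>2 - inverse z / 2 + (a * inverse z + 1) / 8)) \<longlongrightarrow> a) at_infinity"
    by simp
  then show ?thesis
    by (rule Lim_transform_eventually)
      (use eventually_nonzero_at_infinity in eventually_elim, rule stage_factor_rescaled[symmetric])
qed

lemma tendsto_stability_fun_at_infinity:
  "((\<lambda>z. z * stability_fun a z) \<longlongrightarrow> - a) at_infinity"
proof -
  let ?f = "\<lambda>z. (inverse z * (1 + a) + a * (a * inverse z + 1) / 6
       + (a * inverse z - 1) * (a * inverse z + 1) * (z * stage_factor a z) / 3) /
    ((inverse z)\<^sup>2 - inverse z + (a * inverse z + 1) / 6)"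
  \<comment> \<open>Since \<open>z * stage_factor a z\<close> tends to \<open>a\<close>, the stage
    term contributes -a/3 to the numerator; the limit is (a/6 - a/3) / (1/6) = -a.\<close>
  have "(?f \<longlongrightarrow> (0 * (1 + a) + a * (a * 0 + 1) / 6 + (a * 0 - 1) * (a * 0 + 1) * a / 3) /
      (0\<^sup>2 - 0 + (a * 0 + 1) / 6)) at_infinity"
    by (intro tendsto_intros tendsto_inverse_0 tendsto_stage_factor_at_infinity) auto
  then have "(?f \<longlongrightarrow> - a) at_infinity"
    by (simp add: field_simps)
  then show ?thesis
    by (rule Lim_transform_eventually)
      (use eventually_nonzero_at_infinity in eventually_elim, rule stability_fun_rescaled[symmetric])
qed

text \<open>Away from 0, \<open>f z\<close> is the product of \<open>inverse z\<close>, which tends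
  to 0, and the convergent \<open>z * f z\<close>.\<close>

lemma tendsto_0_if_tendsto_times_at_infinity:
  fixes f :: "'a::real_normed_field \<Rightarrow> 'a"
  assumes "((\<lambda>z. z * f z) \<longlongrightarrow> l) at_infinity"
  shows "(f \<longlongrightarrow> 0) at_infinity"
proof -
  have "((\<lambda>z. inverse z * (z * f z)) \<longlongrightarrow> 0 * l) at_infinity"
    by (intro tendsto_mult tendsto_inverse_0 assms)
  then have "((\<lambda>z. inverse z * (z * f z)) \<longlongrightarrow> 0) at_infinity"
    by simp
  then show ?thesis
    by (rule Lim_transform_eventually)
      (use eventually_nonzero_at_infinity in eventually_elim, simp)
qed

theorem mainTheorem3:
  fixes zE :: complex
  shows "((\<lambda>zI. zI * stage_factor zE zI) \<longlongrightarrow> zE) left_half_plane_at_infinity \<and>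
         ((\<lambda>zI. zI * stability_fun zE zI) \<longlongrightarrow> - zE) left_half_plane_at_infinity \<and>
         ((\<lambda>zI. stability_fun zE zI) \<longlongrightarrow> 0) left_half_plane_at_infinity"
proof -
  \<comment> \<open>Restricting \<open>at_infinity\<close> to the half-plane gives a finer filter,
    which inherits every limit.\<close>
  have le: "left_half_plane_at_infinity \<le> at_infinity"
    by (simp add: left_half_plane_at_infinity_def)
  show ?thesis
    using tendsto_stage_factor_at_infinity tendsto_stability_fun_at_infinity
      tendsto_0_if_tendsto_times_at_infinity[OF tendsto_stability_fun_at_infinity]
    by (auto intro: tendsto_mono[OF le])
qed

end
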